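(* Let $S$ be an Arf numerical semigroup with multiplicity $4$ and conductor $s\ge 4$. If $s\equiv 0\bmod 4$, then one of the following holds. (1) $S=\langle 4,4k+2,s+1,s+3\rangle$ for some integer $1\le k<\frac{s}{4}$, $\mathrm{PF}(S)=\{4k-2,s-3,s-1\}$, and: (i) the unique row-factorization matrix of $4k-2$ is \[\begin{bmatrix}-1&1&0&0\\ 2k&-1&0&0\\ k-1&0&-1&1\\ k&0&1&-1\end{bmatrix};\] (ii) the row-factorization matrices of $s-3$ are exactly \[\begin{bmatrix}-1&0&1&0\\ k-1&-1&0&1\\ \frac{s}{2}-a-(2a-1)k&2a-1&-1&0\\ \frac{s}{2}-b-2bk&2b&0&-1\end{bmatrix}\] with $a,b\in\mathbb{N}_0$, $1\le a\le\frac{s+2k}{2(2k+1)}$, $0\le b\le\frac{s}{2(2k+1)}$; (iii) the row-factorization matrices of $s-1$ are exactly \[\begin{bmatrix}-1&0&0&1\\ k&-1&1&0\\ \frac{s}{2}-b-2bk&2b&-1&0\\ \frac{s}{2}-a+1-(2a-1)k&2a-1&0&-1\end{bmatrix}\text{ or }\begin{bmatrix}-1&0&0&1\\ k&-1&1&0\\ \frac{s}{2}-b-2bk&2b&-1&0\\ 0&0&2&-1\end{bmatrix}\] with $a,b\in\mathbb{N}_0$, $1\le a\le\frac{s+2k+2}{2(2k+1)}$, $0\le b\le\frac{s}{2(2k+1)}$. (2) $S=\langle 4,s+1,s+2,s+3\rangle$, $\mathrm{PF}(S)=\{s-3,s-2,s-1\}$; the unique row-factorization matrices of $s-3$ and of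 $s-2$ are, respectively, \[\begin{bmatrix}-1&1&0&0\\ \frac{s-4}{4}&-1&1&0\\ \frac{s-4}{4}&0&-1&1\\ \frac{s}{2}&0&0&-1\end{bmatrix}\text{ and }\begin{bmatrix}-1&0&1&0\\ \frac{s-4}{4}&-1&0&1\\ \frac{s}{2}&0&-1&0\\ \frac{s}{4}&1&0&-1\end{bmatrix};\] and the row-factorization matrices of $s-1$ are exactly \[\begin{bmatrix}-1&0&0&1\\ \frac{s}{2}&-1&0&0\\ \frac{s}{4}&1&-1&0\\ \frac{s}{4}&0&1&-1\end{bmatrix}\text{ and }\begin{bmatrix}-1&0&0&1\\ \frac{s}{2}&-1&0&0\\ \frac{s}{4}&1&-1&0\\ 0&2&0&-1\end{bmatrix}.\]
   Context: A numerical semigroup is a subset $S\subseteq\mathbb{N}_0$ (non-negative integers) containing $0$, closed under addition, with finite complement in $\mathbb{N}_0$; $\langle A\rangle$ is the set of $\mathbb{N}_0$-linear combinations of elements of $A$. The multiplicity is the smallest nonzero element of $S$; the conductor is one plus the greatest integer not in $S$. $S$ is Arf if $s_2+s_3-s_1\in S$ for all $s_1\le s_2\le s_3$ in $S$. $\mathrm{PF}(S)$ is the set of integers $z\notin S$ with $z+x\in S$ for all nonzero $x\in S$. If $n_1<\dots<n_e$ are the minimal generators of $S$, a row-factorization matrix of $f\in\mathrm{PF}(S)$ is an $e\times e$ integer matrix $[a_{ij}]$ with $a_{ii}=-1$, $a_{ij}\in\mathbb{N}_0$ for $i\ne j$, and $f=\sum_{j=1}^e a_{ij}n_j$ for each $i$.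 *)

theory Defs
  imports Complex_Main "Jordan_Normal_Form.Matrix"
begin

definition nat_span :: "nat set \<Rightarrow> nat set" where
  "nat_span A = {\<Sum>x\<in>F. c x * x | F c. finite F \<and> F \<subseteq> A}"

definition numerical_semigroup :: "nat set \<Rightarrow> bool" where
  "numerical_semigroup S \<longleftrightarrow>
     0 \<in> S \<and> (\<forall>x\<in>S. \<forall>y\<in>S. x + y \<in> S) \<and> finite (- S)"

definition semigroup_multiplicity :: "nat set \<Rightarrow> nat" where
  "semigroup_multiplicity S = (LEAST x. x \<in> S \<and> x \<noteq> 0)"

text \<open>The greatest element is taken over the integers, so that the conductor of the
  full semigroup is 0.\<close>
definition conductor :: "nat set \<Rightarrow> int" where
  "conductor S = (GREATEST z::int. z \<notin> int ` S) + 1"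

text \<open>The subtraction on natural numbers does not truncate here because of the ordering
  of the three elements.\<close>
definition arf :: "nat set \<Rightarrow> bool" where
  "arf S \<longleftrightarrow>
     (\<forall>x\<in>S. \<forall>y\<in>S. \<forall>z\<in>S. x \<le> y \<and> y \<le> z \<longrightarrow> y + z - x \<in> S)"

definition pseudo_frobenius :: "nat set \<Rightarrow> int set" where
  "pseudo_frobenius S = {z. z \<notin> int ` S \<and> (\<forall>x\<in>S. x \<noteq> 0 \<longrightarrow> z + int x \<in> int ` S)}"

definition minimal_generating_set :: "nat set \<Rightarrow> nat set \<Rightarrow> bool" where
  "minimal_generating_set S A \<longleftrightarrow> nat_span A = S \<and> (\<forall>B. B \<subset> A \<longrightarrow> nat_span B \<noteq> S)"

text \<open>Well defined and finite for every numerical semigroup, as proved in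
  \<open>minimal_generating_set_ex1\<close> and \<open>finite_minimal_generators\<close> below.\<close>
definition minimal_generators :: "nat set \<Rightarrow> nat set" where
  "minimal_generators S = (THE A. minimal_generating_set S A)"

text \<open>Rows and columns are numbered from 0, and the generators are listed in increasing order.\<close>
definition row_factorization_matrices :: "nat set \<Rightarrow> int \<Rightarrow> int mat set" where
  "row_factorization_matrices S f =
     (let n = sorted_list_of_set (minimal_generators S); e = length n in
      {A \<in> carrier_mat e e.
         (\<forall>i<e. A $$ (i, i) = -1) \<and>
         (\<forall>i<e. \<forall>j<e. i \<noteq> j \<longrightarrow> 0 \<le> A $$ (i, j)) \<and>
         (\<forall>i<e. f = (\<Sum>j<e. A $$ (i, j) * int (n ! j)))})"

lemma nat_span_superset: "A \<subseteq> nat_span A"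
proof
  fix x assume "x \<in> A"
  then show "x \<in> nat_span A"
    unfolding nat_span_def
    by (intro CollectI exI[of _ "{x}"] exI[of _ "\<lambda>_. 1"]) auto
qed

lemma nat_span_zero: "0 \<in> nat_span A"
  unfolding nat_span_def by (intro CollectI exI[of _ "{}"]) auto

lemma nat_span_mono: "A \<subseteq> B \<Longrightarrow> nat_span A \<subseteq> nat_span B"
  unfolding nat_span_def by blast

lemma nat_span_add:
  assumes "x \<in> nat_span A" "y \<in> nat_span A"
  shows "x + y \<in> nat_span A"
proof -
  obtain F c where F: "finite F" "F \<subseteq> A" "x = (\<Sum>a\<in>F. c a * a)"
    using assms(1) unfolding nat_span_def by blast
  obtain G d where G: "finite G" "G \<subseteq> A" "y = (\<Sum>a\<in>G. d a * a)"
    using assms(2) unfolding nat_span_def by blast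
  define c' where "c' a = (if a \<in> F then c a else 0)" for a
  define d' where "d' a = (if a \<in> G then d a else 0)" for a
  have "x = (\<Sum>a\<in>F \<union> G. c' a * a)"
    unfolding F(3) by (rule sum.mono_neutral_cong_left) (use F G in \<open>auto simp: c'_def\<close>)
  moreover have "y = (\<Sum>a\<in>F \<union> G. d' a * a)"
    unfolding G(3) by (rule sum.mono_neutral_cong_left) (use F G in \<open>auto simp: d'_def\<close>)
  ultimately have "x + y = (\<Sum>a\<in>F \<union> G. (c' a + d' a) * a)"
    by (simp add: sum.distrib algebra_simps)
  then show ?thesis
    unfolding nat_span_def using F G
    by (intro CollectI exI[of _ "F \<union> G"] exI[of _ "\<lambda>a. c' a + d' a"]) auto
qed

lemma nat_span_least:
  assumes "A \<subseteq> T" "0 \<in> T" "\<And>x y. x \<in> T \<Longrightarrow> y \<in> T \<Longrightarrow> x + y \<in> T"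
  shows "nat_span A \<subseteq> T"
proof -
  have mult: "c * x \<in> T" if "x \<in> T" for c x :: nat
    by (induction c) (simp_all add: assms(2,3) that)
  have "(\<Sum>x\<in>F. c x * x) \<in> T" if "finite F" "F \<subseteq> A" for F c
    using that
  proof (induction F)
    case (insert x F)
    then have "x \<in> T" "(\<Sum>x\<in>F. c x * x) \<in> T" using assms(1) by blast+
    then show ?case using insert.hyps assms(3) mult by simp
  qed (simp add: assms(2))
  then show ?thesis unfolding nat_span_def by blast
qed

lemma nat_span_imp_sum:
  assumes "x \<in> nat_span A"
  shows "x = 0 \<or> x \<in> A \<or> (\<exists>y\<in>nat_span A. \<exists>z\<in>nat_span A. x = y + z \<and> y < x \<and> z < x)"
proof -
  let ?T = "{x \<in> nat_span A. x = 0 \<or> x \<in> A \<or>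
      (\<exists>y\<in>nat_span A. \<exists>z\<in>nat_span A. x = y + z \<and> y < x \<and> z < x)}"
  have "nat_span A \<subseteq> ?T"
  proof (rule nat_span_least)
    show "A \<subseteq> ?T" using nat_span_superset[of A] by blast
    show "0 \<in> ?T" using nat_span_zero[of A] by blast
  next
    fix x y assume x: "x \<in> ?T" and y: "y \<in> ?T"
    then have xy: "x \<in> nat_span A" "y \<in> nat_span A" by blast+
    consider "x = 0" | "y = 0" | "x < x + y" "y < x + y" by linarith
    then show "x + y \<in> ?T"
    proof cases
      case 3
      then have "\<exists>u\<in>nat_span A. \<exists>v\<in>nat_span A. x + y = u + v \<and> u < x + y \<and> v < x + y"
        using xy by blast
      then show ?thesis using nat_span_add[OF xy] by blast
    next
      case 1
      then show ?thesis using y by (simp only: add_0)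
    next
      case 2
      then show ?thesis using x by (simp only: add_0_right)
    qed
  qed
  then show ?thesis using assms by blast
qed

lemma minimal_generating_set_ex1:
  assumes "numerical_semigroup S"
  shows "\<exists>!A. minimal_generating_set S A"
proof -
  have S: "0 \<in> S" "\<And>x y. x \<in> S \<Longrightarrow> y \<in> S \<Longrightarrow> x + y \<in> S"
    using assms unfolding numerical_semigroup_def by auto
  define M where
    "M = {x \<in> S. x \<noteq> 0 \<and> \<not> (\<exists>y\<in>S. \<exists>z\<in>S. x = y + z \<and> y < x \<and> z < x)}"
  have "x \<in> nat_span M" if "x \<in> S" for x
    using that
  proof (induction x rule: less_induct)
    case (less x)
    consider "x = 0" | "x \<in> M" | y z where "y \<in> S" "z \<in> S" "x = y + z" "y < x" "z < x"
      using less.prems unfolding M_def by blast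
    then show ?case
    proof cases
      case 1
      then show ?thesis by (simp only: nat_span_zero)
    next
      case 2
      then show ?thesis using nat_span_superset[of M] by blast
    next
      case 3
      have "y + z \<in> nat_span M"
        by (rule nat_span_add) (rule less.IH[OF \<open>y < x\<close> \<open>y \<in> S\<close>], rule less.IH[OF \<open>z < x\<close> \<open>z \<in> S\<close>])
      then show ?thesis by (simp only: \<open>x = y + z\<close>)
    qed
  qed
  moreover have "nat_span M \<subseteq> S"
  proof (rule nat_span_least)
    show "M \<subseteq> S" unfolding M_def by blast
  qed (simp_all add: S)
  ultimately have span: "nat_span M = S" by blast
  have sub: "M \<subseteq> A" if "nat_span A = S" for A
  proof
    fix x assume "x \<in> M"
    then have "x \<in> nat_span A" "x \<noteq> 0"
        "\<not> (\<exists>y\<in>nat_span A. \<exists>z\<in>nat_span A. x = y + z \<and> y < x \<and> z < x)"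
      unfolding M_def that by blast+
    then show "x \<in> A" using nat_span_imp_sum[of x A] by blast
  qed
  show ?thesis
  proof (rule ex1I[of _ M])
    show "minimal_generating_set S M"
      unfolding minimal_generating_set_def using span sub by blast
  next
    fix A assume "minimal_generating_set S A"
    then show "A = M"
      unfolding minimal_generating_set_def using span sub by blast
  qed
qed

lemma minimal_generating_set_minimal_generators:
  assumes "numerical_semigroup S"
  shows "minimal_generating_set S (minimal_generators S)"
  unfolding minimal_generators_def by (rule theI'[OF minimal_generating_set_ex1[OF assms]])

lemma finite_minimal_generators:
  assumes "numerical_semigroup S"
  shows "finite (minimal_generators S)"
proof -
  have S: "0 \<in> S" "\<And>x y. x \<in> S \<Longrightarrow> y \<in> S \<Longrightarrow> x + y \<in> S" "finite (- S)"
    using assms unfolding numerical_semigroup_def by auto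
  let ?M = "minimal_generators S"
  have M: "nat_span ?M = S" "\<And>B. B \<subset> ?M \<Longrightarrow> nat_span B \<noteq> S"
    using minimal_generating_set_minimal_generators[OF assms]
    unfolding minimal_generating_set_def by auto
  obtain N where "\<forall>x\<in>- S. x < N"
    using S(3) unfolding finite_nat_set_iff_bounded by blast
  then have N: "x \<in> S" if "x \<ge> N" for x
    using that by (meson ComplI not_le)
  have "x < 2 * N + 2" if x: "x \<in> ?M" for x
  proof (rule ccontr)
    assume "\<not> x < 2 * N + 2"
    define y z where "y = N + 1" and "z = x - y"
    have "N \<le> y" "N \<le> z" and yz: "x = y + z" "y < x" "z < x"
      using \<open>\<not> x < 2 * N + 2\<close> unfolding y_def z_def by linarith+
    then have yz_in: "y \<in> S" "z \<in> S" using N by blast+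
    have below: "w \<in> nat_span (?M - {x})" if "w \<in> S" "w < x" for w
      using that
    proof (induction w rule: less_induct)
      case (less w)
      consider "w = 0" | "w \<in> ?M" | u v where "u \<in> S" "v \<in> S" "w = u + v" "u < w" "v < w"
        using nat_span_imp_sum[of w ?M] less.prems M(1) by blast
      then show ?case
      proof cases
        case 2
        then show ?thesis using nat_span_superset[of "?M - {x}"] less.prems by blast
      next
        case 3
        then have "u \<in> nat_span (?M - {x})" "v \<in> nat_span (?M - {x})"
          using less.IH[of u] less.IH[of v] less.prems(2) by (meson less_trans)+
        then show ?thesis unfolding \<open>w = u + v\<close> by (rule nat_span_add)
      qed (simp only: nat_span_zero)
    qed
    have xin: "x \<in> nat_span (?M - {x})"
    proof -
      have "y + z \<in> nat_span (?M - {x})"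
        by (rule nat_span_add) (rule below[OF yz_in(1) yz(2)], rule below[OF yz_in(2) yz(3)])
      then show ?thesis by (simp only: yz(1)[symmetric])
    qed
    have "nat_span ?M \<subseteq> nat_span (?M - {x})"
    proof (rule nat_span_least)
      show "?M \<subseteq> nat_span (?M - {x})"
        using xin nat_span_superset[of "?M - {x}"] by blast
    qed (simp_all add: nat_span_zero nat_span_add)
    moreover have "nat_span (?M - {x}) \<subseteq> nat_span ?M" by (rule nat_span_mono) auto
    ultimately show False using M x by blast
  qed
  then show ?thesis by (meson finite_nat_set_iff_bounded)
qed

end

theory Submission
  imports Defs
begin

text \<open>
  Write \<open>s = 4 * q\<close>. The conductor makes \<open>s - 1\<close> a gap, and \<open>4 \<in> S\<close>, so no element below \<open>s\<close>
  is \<open>3\<close> modulo \<open>4\<close>. The Arf property removes the residue \<open>1\<close> as well: from \<open>4 * i\<close> and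
  \<open>4 * i + 1\<close> it produces \<open>4 * i + 2\<close>, and then from \<open>4 * i + 1\<close> and \<open>4 * i + 2\<close> it produces
  \<open>4 * i + 3\<close>. Hence \<open>S\<close> consists of the multiples of \<open>4\<close>, the numbers \<open>4 * i + 2\<close> with \<open>i \<ge> k\<close>
  for one parameter \<open>1 \<le> k \<le> q\<close>, and everything from \<open>s\<close> on
  (\<open>arf_multiplicity_4_eq_even_gap_semigroup\<close>). Both alternatives of the theorem are this one
  family: \<open>k < q\<close> gives the first, and \<open>k = q\<close> the second, where \<open>4 * k + 2 = s + 2\<close> has moved
  between the two odd generators. The minimal generators \<open>4\<close>, \<open>4 * k + 2\<close>, \<open>s + 1\<close>, \<open>s + 3\<close> and the
  pseudo-Frobenius numbers \<open>4 * k - 2\<close>, \<open>s - 3\<close>, \<open>s - 1\<close> are therefore computed for all \<open>k\<close> at once.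

  The rows of a row-factorization matrix of \<open>f\<close> can be chosen independently: row \<open>i\<close> is a
  factorization of \<open>f + n\<^sub>i\<close> that avoids the generator \<open>n\<^sub>i\<close>
  (\<open>row_factorization_matrices_eq_rows\<close>). The numbers to be factored are at most
  \<open>2 * s + 2 = (s + 1) + (s + 1)\<close>, so the odd generators occur at most once, except in the
  factorization \<open>2 * (s + 1)\<close> of the extreme value. What is left over is a combination
  of \<open>4\<close> and \<open>4 * k + 2\<close>, where the only freedom is to trade two copies of \<open>4 * k + 2\<close> for
  \<open>2 * k + 1\<close> copies of \<open>4\<close>. This trade is the origin of the parameters \<open>a\<close> and \<open>b\<close>, and
  their bounds say that the coefficient of \<open>4\<close> stays non-negative.
\<close>

section \<open>Arf semigroups of multiplicity 4\<close>

lemma conductorD: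
  assumes "numerical_semigroup S" "conductor S = int s"
  shows "\<And>x. s \<le> x \<Longrightarrow> x \<in> S" and "int s - 1 \<notin> int ` S"
proof -
  \<comment> \<open>The integer \<open>-1\<close> is never in \<open>S\<close>, so it can stand for all negative integers when the
    greatest integer outside \<open>S\<close> is sought.\<close>
  let ?G = "insert (-1) (int ` (- S))"
  have fin: "finite ?G" using assms(1) unfolding numerical_semigroup_def by simp
  have above: "z \<le> Max ?G" if "z \<notin> int ` S" for z
  proof (cases "z < 0")
    case True
    have "-1 \<le> Max ?G" using fin by (intro Max_ge) auto
    with True show ?thesis by linarith
  next
    case False
    then have "z = int (nat z)" "nat z \<notin> S" using that by (auto simp: image_iff)
    then have "z \<in> ?G" by blast
    then show ?thesis using fin by (intro Max_ge)
  qed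
  have "Max ?G \<in> ?G" using fin by (intro Max_in) auto
  then have gap: "Max ?G \<notin> int ` S" by auto
  have "(GREATEST z. z \<notin> int ` S) = Max ?G"
    by (rule Greatest_equality) (use gap above in auto)
  then have Max: "Max ?G = int s - 1" using assms(2) unfolding conductor_def by simp
  show "int s - 1 \<notin> int ` S" using gap Max by simp
  show "x \<in> S" if "s \<le> x" for x
    using above[of "int x"] Max that by fastforce
qed

lemma mod_4_cases:
  fixes x :: nat
  obtains i where "x = 4 * i" | i where "x = 4 * i + 1" | i where "x = 4 * i + 2" | i where "x = 4 * i + 3"
proof -
  have "x = 4 * (x div 4) + x mod 4" by simp
  moreover consider "x mod 4 = 0" | "x mod 4 = 1" | "x mod 4 = 2" | "x mod 4 = 3" by linarith
  ultimately show thesis using that by cases (metis add_0_right)+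
qed

text \<open>The existential form, with one quotient \<open>i\<close> for all residues modulo \<open>4\<close>, turns membership
  into linear conditions on \<open>i\<close>. For \<open>k \<le> q\<close> the set contains every number from \<open>4 * q\<close> on.\<close>
definition even_gap_semigroup :: "nat \<Rightarrow> nat \<Rightarrow> nat set" where
  "even_gap_semigroup k q =
    {x. \<exists>i. x = 4 * i \<or> x = 4 * i + 2 \<and> k \<le> i \<or> (x = 4 * i + 1 \<or> x = 4 * i + 3) \<and> q \<le> i}"

lemma mem_even_gap_semigroup_iff:
  "x \<in> even_gap_semigroup k q \<longleftrightarrow>
    (\<exists>i. x = 4 * i \<or> x = 4 * i + 2 \<and> k \<le> i \<or> (x = 4 * i + 1 \<or> x = 4 * i + 3) \<and> q \<le> i)"
  by (simp add: even_gap_semigroup_def)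

lemma mem_even_gap_semigroup:
  "4 * i \<in> even_gap_semigroup k q"
  "4 * i + 1 \<in> even_gap_semigroup k q \<longleftrightarrow> q \<le> i"
  "4 * i + 2 \<in> even_gap_semigroup k q \<longleftrightarrow> k \<le> i"
  "4 * i + 3 \<in> even_gap_semigroup k q \<longleftrightarrow> q \<le> i"
proof -
  have "4 * i + 1 \<noteq> 4 * j" "4 * i + 2 \<noteq> 4 * j" "4 * i + 3 \<noteq> 4 * j" "4 * i + 1 \<noteq> 4 * j + 2"
    "4 * i + 1 \<noteq> 4 * j + 3" "4 * i + 2 \<noteq> 4 * j + 1" "4 * i + 2 \<noteq> 4 * j + 3" "4 * i + 3 \<noteq> 4 * j + 1"
    "4 * i + 3 \<noteq> 4 * j + 2" for i j :: nat
    by presburger+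
  then show "4 * i \<in> even_gap_semigroup k q" "4 * i + 1 \<in> even_gap_semigroup k q \<longleftrightarrow> q \<le> i"
    "4 * i + 2 \<in> even_gap_semigroup k q \<longleftrightarrow> k \<le> i" "4 * i + 3 \<in> even_gap_semigroup k q \<longleftrightarrow> q \<le> i"
    unfolding mem_even_gap_semigroup_iff by auto
qed

text \<open>Membership is upward closed in each residue class modulo \<open>4\<close>, since \<open>4 \<in> S\<close>; so each class is
  described by the place where it starts. The class of \<open>3\<close> starts right after the gap \<open>4 * q - 1\<close>,
  the Arf property forces the class of \<open>1\<close> to start no earlier, and the class of \<open>2\<close> starts at
  some \<open>k\<close> between \<open>1\<close> and \<open>q\<close>.\<close>
lemma arf_multiplicity_4_eq_even_gap_semigroup:
  assumes "numerical_semigroup S" "arf S" "semigroup_multiplicity S = 4"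
    and "conductor S = int (4 * q)" "1 \<le> q"
  shows "\<exists>k. 1 \<le> k \<and> k \<le> q \<and> S = even_gap_semigroup k q"
proof -
  have zero: "0 \<in> S" and add: "\<And>x y. x \<in> S \<Longrightarrow> y \<in> S \<Longrightarrow> x + y \<in> S"
    using assms(1) unfolding numerical_semigroup_def by auto
  have arf: "y + z - x \<in> S" if "x \<in> S" "y \<in> S" "z \<in> S" "x \<le> y" "y \<le> z" for x y z
    using assms(2) that unfolding arf_def by blast
  note large = conductorD(1)[OF assms(1,4)]
  have frob: "4 * (q - 1) + 3 \<notin> S"
  proof
    assume "4 * (q - 1) + 3 \<in> S"
    then have "int (4 * (q - 1) + 3) \<in> int ` S" by (rule imageI)
    moreover have "int (4 * (q - 1) + 3) = int (4 * q) - 1" using assms(5) by linarith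
    ultimately show False using conductorD(2)[OF assms(1,4)] by simp
  qed
  have "4 * q + 1 \<in> S \<and> 4 * q + 1 \<noteq> 0" using large by simp
  then have "4 \<in> S" using assms(3) unfolding semigroup_multiplicity_def
    by (metis (mono_tags, lifting) LeastI)
  have two: "2 \<notin> S" using assms(3) not_less_Least[of 2 "\<lambda>x. x \<in> S \<and> x \<noteq> 0"]
    unfolding semigroup_multiplicity_def by auto
  have shift: "4 * j + r \<in> S" if "4 * i + r \<in> S" "i \<le> j" for i j r
    using that(2)
  proof (induction j rule: dec_induct)
    case (step j)
    have "4 * Suc j + r = (4 * j + r) + 4" by simp
    then show ?case using add[OF step.IH \<open>4 \<in> S\<close>] by (simp only:)
  qed (rule that(1))
  have mem0: "4 * i \<in> S" for i using shift[of 0 0 i] zero by simp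
  have mem3: "4 * i + 3 \<in> S \<longleftrightarrow> q \<le> i" for i
  proof -
    have "i \<le> q - 1 \<longleftrightarrow> \<not> q \<le> i" using assms(5) by linarith
    then show ?thesis using shift[of i 3 "q - 1"] frob large[of "4 * i + 3"] by auto
  qed
  have mem1: "4 * i + 1 \<in> S \<longleftrightarrow> q \<le> i" for i
  proof
    assume i: "4 * i + 1 \<in> S"
    then have "(4 * i + 1) + (4 * i + 1) - 4 * i \<in> S" using mem0 by (intro arf) auto
    then have "4 * i + 2 \<in> S" by simp
    then have "(4 * i + 2) + (4 * i + 2) - (4 * i + 1) \<in> S" using i by (intro arf) auto
    then have "4 * i + 3 \<in> S" by (simp add: eval_nat_numeral)
    then show "q \<le> i" using mem3 by blast
  qed (use large in simp)
  define k where "k = (LEAST i. 4 * i + 2 \<in> S)"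
  have "4 * q + 2 \<in> S" using large by simp
  then have k: "4 * k + 2 \<in> S" "k \<le> q" unfolding k_def by (rule LeastI, rule Least_le)
  have mem2: "4 * i + 2 \<in> S \<longleftrightarrow> k \<le> i" for i
    using shift[OF k(1)] Least_le[of "\<lambda>i. 4 * i + 2 \<in> S" i] unfolding k_def by blast
  have "k \<noteq> 0" using two k(1) by (intro notI) (simp add: numeral_2_eq_2)
  have "x \<in> S \<longleftrightarrow> x \<in> even_gap_semigroup k q" for x
    by (cases x rule: mod_4_cases) (simp_all only: mem_even_gap_semigroup mem0 mem1 mem2 mem3)
  then show ?thesis using \<open>k \<noteq> 0\<close> \<open>k \<le> q\<close> by (intro exI[of _ k]) auto
qed

section \<open>Pseudo-Frobenius numbers and minimal generators\<close>

lemma int_mem_even_gap_semigroup_iff: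
  "z \<in> int ` even_gap_semigroup k q \<longleftrightarrow>
    (\<exists>i\<ge>0. z = 4 * i \<or> z = 4 * i + 2 \<and> int k \<le> i \<or> (z = 4 * i + 1 \<or> z = 4 * i + 3) \<and> int q \<le> i)"
proof -
  have "z \<in> int ` even_gap_semigroup k q \<longleftrightarrow> (\<exists>i. z = int (4 * i) \<or> z = int (4 * i + 2) \<and> k \<le> i
      \<or> (z = int (4 * i + 1) \<or> z = int (4 * i + 3)) \<and> q \<le> i)"
    unfolding image_iff Bex_def mem_even_gap_semigroup_iff by blast
  also have "\<dots> \<longleftrightarrow> (\<exists>i. z = 4 * int i \<or> z = 4 * int i + 2 \<and> int k \<le> int i
      \<or> (z = 4 * int i + 1 \<or> z = 4 * int i + 3) \<and> int q \<le> int i)"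
    by (simp add: algebra_simps)
  also have "\<dots> \<longleftrightarrow> (\<exists>i\<ge>0. z = 4 * i \<or> z = 4 * i + 2 \<and> int k \<le> i \<or> (z = 4 * i + 1 \<or> z = 4 * i + 3) \<and> int q \<le> i)"
    by (metis nonneg_int_cases of_nat_0_le_iff)
  finally show ?thesis .
qed

text \<open>If \<open>z\<close> is pseudo-Frobenius, then \<open>z + 4\<close> is the first element of its residue class. This leaves
  four candidates, one per class, and the candidate \<open>-4\<close> fails because \<open>-4 + (4 * k + 2)\<close> is a
  gap.\<close>
lemma pseudo_frobenius_even_gap_semigroup:
  assumes "1 \<le> k" "k \<le> q"
  shows "pseudo_frobenius (even_gap_semigroup k q) = {4 * int k - 2, 4 * int q - 3, 4 * int q - 1}"
proof (intro equalityI subsetI)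
  let ?E = "even_gap_semigroup k q"
  fix z assume z: "z \<in> pseudo_frobenius ?E"
  have "4 \<in> ?E" "4 * k + 2 \<in> ?E"
    using mem_even_gap_semigroup(1)[of 1 k q] mem_even_gap_semigroup(3)[of k k q] by simp_all
  then have out: "z \<notin> int ` ?E" and in4: "z + int 4 \<in> int ` ?E"
      and in2: "z + int (4 * k + 2) \<in> int ` ?E"
    using z unfolding pseudo_frobenius_def by force+
  obtain i where i: "0 \<le> i" "z + 4 = 4 * i \<or> z + 4 = 4 * i + 2 \<and> int k \<le> i
      \<or> (z + 4 = 4 * i + 1 \<or> z + 4 = 4 * i + 3) \<and> int q \<le> i"
    using in4 unfolding int_mem_even_gap_semigroup_iff by auto
  obtain j where j: "0 \<le> j" "z + (4 * int k + 2) = 4 * j \<or> z + (4 * int k + 2) = 4 * j + 2 \<and> int k \<le> j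
      \<or> (z + (4 * int k + 2) = 4 * j + 1 \<or> z + (4 * int k + 2) = 4 * j + 3) \<and> int q \<le> j"
    using in2 unfolding int_mem_even_gap_semigroup_iff by auto
  have out': "\<not> (0 \<le> l \<and> (z = 4 * l \<or> z = 4 * l + 2 \<and> int k \<le> l
      \<or> (z = 4 * l + 1 \<or> z = 4 * l + 3) \<and> int q \<le> l))" for l
    using out unfolding int_mem_even_gap_semigroup_iff by blast
  from i(2) consider "z = 4 * (i - 1)" | "z = 4 * (i - 1) + 2" "int k \<le> i"
    | "z = 4 * (i - 1) + 1" "int q \<le> i" | "z = 4 * (i - 1) + 3" "int q \<le> i"
    by (elim disjE conjE) simp_all
  then show "z \<in> {4 * int k - 2, 4 * int q - 3, 4 * int q - 1}"
  proof cases
    case 1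
    then have "\<not> 0 \<le> i - 1" using out' by blast
    then have "i = 0" using i(1) by simp
    then have "z = -4" using 1 by simp
    with j have False by presburger
    then show ?thesis ..
  next
    case 2
    then have "\<not> (0 \<le> i - 1 \<and> int k \<le> i - 1)" using out' by blast
    then have "i = int k" using 2 assms by linarith
    then show ?thesis using 2 by simp
  next
    case 3
    then have "\<not> (0 \<le> i - 1 \<and> int q \<le> i - 1)" using out' by blast
    then have "i = int q" using 3 assms by linarith
    then show ?thesis using 3 by simp
  next
    case 4
    then have "\<not> (0 \<le> i - 1 \<and> int q \<le> i - 1)" using out' by blast
    then have "i = int q" using 4 assms by linarith
    then show ?thesis using 4 by simp
  qed
next
  let ?E = "even_gap_semigroup k q"
  fix z assume z: "z \<in> {4 * int k - 2, 4 * int q - 3, 4 * int q - 1}"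
  have "z \<notin> int ` ?E"
    using assms z unfolding int_mem_even_gap_semigroup_iff by auto presburger+
  moreover have "z + int x \<in> int ` ?E" if "x \<in> ?E" "x \<noteq> 0" for x
  proof -
    obtain i where i: "x = 4 * i \<or> x = 4 * i + 2 \<and> k \<le> i \<or> (x = 4 * i + 1 \<or> x = 4 * i + 3) \<and> q \<le> i"
      using \<open>x \<in> ?E\<close> unfolding mem_even_gap_semigroup_iff by blast
    let ?P = "\<lambda>l. 0 \<le> l \<and> (z + int x = 4 * l \<or> z + int x = 4 * l + 2 \<and> int k \<le> l
      \<or> (z + int x = 4 * l + 1 \<or> z + int x = 4 * l + 3) \<and> int q \<le> l)"
    \<comment> \<open>Adding \<open>x\<close> with quotient \<open>i\<close> to \<open>z\<close> with quotient \<open>k - 1\<close> or \<open>q - 1\<close> produces a carry or not.\<close>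
    have "?P (int k + int i - 1) \<or> ?P (int k + int i) \<or> ?P (int q + int i - 1) \<or> ?P (int q + int i)"
      using i z \<open>x \<noteq> 0\<close> assms unfolding insert_iff empty_iff by (elim disjE conjE) simp_all
    then show ?thesis unfolding int_mem_even_gap_semigroup_iff by blast
  qed
  ultimately show "z \<in> pseudo_frobenius ?E"
    unfolding pseudo_frobenius_def by blast
qed

lemma even_gap_semigroup_add:
  assumes "x \<in> even_gap_semigroup k q" "y \<in> even_gap_semigroup k q" "k \<le> q"
  shows "x + y \<in> even_gap_semigroup k q"
proof -
  obtain i where "x = 4 * i \<or> x = 4 * i + 2 \<and> k \<le> i \<or> (x = 4 * i + 1 \<or> x = 4 * i + 3) \<and> q \<le> i"
    using assms(1) unfolding mem_even_gap_semigroup_iff by blast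
  moreover obtain j where "y = 4 * j \<or> y = 4 * j + 2 \<and> k \<le> j \<or> (y = 4 * j + 1 \<or> y = 4 * j + 3) \<and> q \<le> j"
    using assms(2) unfolding mem_even_gap_semigroup_iff by blast
  ultimately have "\<exists>l\<in>{i + j, i + j + 1}. x + y = 4 * l \<or> x + y = 4 * l + 2 \<and> k \<le> l
      \<or> (x + y = 4 * l + 1 \<or> x + y = 4 * l + 3) \<and> q \<le> l"
    unfolding bex_simps using assms(3) by (elim disjE conjE) simp_all
  then show ?thesis unfolding mem_even_gap_semigroup_iff by blast
qed

text \<open>A generator that is not a sum of two smaller elements cannot be spanned by the others, so a
  generating set of such elements cannot be shrunk.\<close>
lemma minimal_generatorsI:
  assumes "numerical_semigroup S" "nat_span A = S" "0 \<notin> A"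
    and indec: "\<And>a y z. a \<in> A \<Longrightarrow> y \<in> S \<Longrightarrow> z \<in> S \<Longrightarrow> y < a \<Longrightarrow> z < a \<Longrightarrow> a \<noteq> y + z"
  shows "minimal_generators S = A"
proof -
  have "nat_span B \<noteq> S" if "B \<subset> A" for B
  proof
    assume B: "nat_span B = S"
    obtain a where a: "a \<in> A" "a \<notin> B" using \<open>B \<subset> A\<close> by blast
    then have "a \<in> nat_span B" using assms(2) B nat_span_superset by blast
    then show False using nat_span_imp_sum[of a B] a assms(3) indec[OF a(1)] B by blast
  qed
  then have "minimal_generating_set S A"
    unfolding minimal_generating_set_def using assms(2) by blast
  then show ?thesis
    using minimal_generating_set_ex1[OF assms(1)] minimal_generating_set_minimal_generators[OF assms(1)]
    by blast
qed

text \<open>The generators other than \<open>4\<close> are the first elements of the non-zero residue classes, from which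
  the rest is reached by adding multiples of \<open>4\<close>.\<close>
lemma nat_span_even_gap_semigroup:
  assumes "1 \<le> k" "k \<le> q"
  shows "nat_span {4, 4 * k + 2, 4 * q + 1, 4 * q + 3} = even_gap_semigroup k q" (is "nat_span ?A = _")
proof
  show "nat_span ?A \<subseteq> even_gap_semigroup k q"
  proof (rule nat_span_least)
    show "0 \<in> even_gap_semigroup k q" "?A \<subseteq> even_gap_semigroup k q"
      using mem_even_gap_semigroup(1)[of 0 k q] mem_even_gap_semigroup(1)[of 1 k q]
        mem_even_gap_semigroup(2)[of q k q] mem_even_gap_semigroup(3)[of k k q]
        mem_even_gap_semigroup(4)[of q k q] by simp_all
  qed (rule even_gap_semigroup_add[OF _ _ assms(2)])
  have gen: "a + 4 * m \<in> nat_span ?A" if "a \<in> nat_span ?A" for a m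
  proof (induction m)
    case (Suc m)
    have "a + 4 * Suc m = (a + 4 * m) + 4" by simp
    moreover have "4 \<in> nat_span ?A" using nat_span_superset[of ?A] by blast
    ultimately show ?case using nat_span_add[OF Suc] by (simp only:)
  qed (use that in \<open>simp only: mult_0_right add_0_right\<close>)
  show "even_gap_semigroup k q \<subseteq> nat_span ?A"
  proof
    fix x assume "x \<in> even_gap_semigroup k q"
    then obtain i where
      "x = 4 * i \<or> x = 4 * i + 2 \<and> k \<le> i \<or> (x = 4 * i + 1 \<or> x = 4 * i + 3) \<and> q \<le> i"
      unfolding mem_even_gap_semigroup_iff by blast
    then have "x = 0 + 4 * i \<or> x = (4 * k + 2) + 4 * (i - k)
        \<or> x = (4 * q + 1) + 4 * (i - q) \<or> x = (4 * q + 3) + 4 * (i - q)"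
      by linarith
    then obtain a m where "a \<in> insert 0 ?A" "x = a + 4 * m" by blast
    moreover from this have "a \<in> nat_span ?A"
      using nat_span_superset[of ?A] nat_span_zero[of ?A] by blast
    ultimately show "x \<in> nat_span ?A" using gen[of a m] by (simp only:)
  qed
qed

lemma even_gap_semigroup_lower_bound:
  assumes "x \<in> even_gap_semigroup k q" "1 \<le> k" "k \<le> q"
  shows "x = 0 \<or> 4 \<le> x" "odd x \<Longrightarrow> 4 * q + 1 \<le> x" "x = 4 * l + 2 \<Longrightarrow> k \<le> l"
proof -
  obtain i where "x = 4 * i \<or> x = 4 * i + 2 \<and> k \<le> i \<or> (x = 4 * i + 1 \<or> x = 4 * i + 3) \<and> q \<le> i"
    using assms(1) unfolding mem_even_gap_semigroup_iff by blast
  then show "x = 0 \<or> 4 \<le> x" "odd x \<Longrightarrow> 4 * q + 1 \<le> x" using assms(2,3) by auto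
  show "x = 4 * l + 2 \<Longrightarrow> k \<le> l" using assms(1) mem_even_gap_semigroup(3) by simp
qed

text \<open>If a generator were a sum of two smaller elements, both summands would be at least \<open>4\<close>. For
  \<open>4 * k + 2\<close> one of them would be odd or \<open>2\<close> modulo \<open>4\<close>, and for an odd generator one of them
  would be odd; in both cases this summand is so large that the other one falls below \<open>4\<close>.\<close>
lemma minimal_generators_even_gap_semigroup:
  assumes "numerical_semigroup (even_gap_semigroup k q)" "1 \<le> k" "k \<le> q"
  shows "minimal_generators (even_gap_semigroup k q) = {4, 4 * k + 2, 4 * q + 1, 4 * q + 3}"
proof (rule minimal_generatorsI[OF assms(1) nat_span_even_gap_semigroup[OF assms(2,3)]])
  fix a y z
  assume a: "a \<in> {4, 4 * k + 2, 4 * q + 1, 4 * q + 3}" and y: "y \<in> even_gap_semigroup k q"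
    and z: "z \<in> even_gap_semigroup k q" and "y < a" "z < a"
  note y = even_gap_semigroup_lower_bound[OF y assms(2,3)]
  note z = even_gap_semigroup_lower_bound[OF z assms(2,3)]
  show "a \<noteq> y + z"
  proof
    assume sum: "a = y + z"
    then have "4 \<le> y" "4 \<le> z" using y(1) z(1) \<open>y < a\<close> \<open>z < a\<close> by linarith+
    consider "a = 4" | "a = 4 * k + 2" | "odd a" "a \<le> 4 * q + 3" using a by auto
    then show False
    proof cases
      case 1
      then show False using sum \<open>4 \<le> y\<close> \<open>4 \<le> z\<close> by linarith
    next
      case 2
      consider "odd y" | l where "y = 4 * l + 2" | l where "y = 4 * l"
        by (cases y rule: mod_4_cases) auto
      then show False
      proof cases
        case 1
        then show False using y(2) 2 sum \<open>4 \<le> z\<close> assms(3) by linarith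
      next
        case (2 l)
        then show False using y(3)[OF 2] \<open>a = 4 * k + 2\<close> sum \<open>4 \<le> z\<close> by linarith
      next
        case (3 l)
        then have "z = 4 * (k - l) + 2" using 2 sum by linarith
        then show False using z(3)[of "k - l"] 3 \<open>4 \<le> y\<close> assms(2) by linarith
      qed
    next
      case 3
      then have "odd y \<or> odd z" using sum by auto
      then have "4 * q + 1 \<le> y \<or> 4 * q + 1 \<le> z" using y(2) z(2) by blast
      then show False using 3 sum \<open>4 \<le> y\<close> \<open>4 \<le> z\<close> by linarith
    qed
  qed
qed simp

section \<open>Row-factorization matrices as independent choices of rows\<close>

definition row_factorizations :: "nat list \<Rightarrow> int \<Rightarrow> nat \<Rightarrow> int list set" where
  "row_factorizations n f i =
    {r. length r = length n \<and> r ! i = -1 \<and> (\<forall>j<length n. i \<noteq> j \<longrightarrow> 0 \<le> r ! j) \<and>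
        f = (\<Sum>j<length n. r ! j * int (n ! j))}"

text \<open>No condition on a row-factorization matrix involves two rows, so the matrices form a product of
  sets of rows.\<close>
lemma row_factorization_matrices_eq_rows:
  fixes S :: "nat set"
  defines "n \<equiv> sorted_list_of_set (minimal_generators S)"
  shows "row_factorization_matrices S f =
    {mat_of_rows_list (length n) rs | rs. length rs = length n \<and>
        (\<forall>i<length n. rs ! i \<in> row_factorizations n f i)}" (is "?L = ?R")
proof (intro equalityI subsetI)
  fix A assume A: "A \<in> ?L"
  let ?rs = "map (\<lambda>i. map (\<lambda>j. A $$ (i, j)) [0..<length n]) [0..<length n]"
  have "A = mat_of_rows_list (length n) ?rs"
    using A unfolding row_factorization_matrices_def Let_def n_def[symmetric] mat_of_rows_list_def
    by (intro eq_matI) auto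
  moreover have "?rs ! i \<in> row_factorizations n f i" if "i < length n" for i
    using A that unfolding row_factorization_matrices_def Let_def n_def[symmetric] row_factorizations_def
    by auto
  moreover have "length ?rs = length n" by simp
  ultimately show "A \<in> ?R" by blast
next
  fix A assume "A \<in> ?R"
  then obtain rs where A: "A = mat_of_rows_list (length n) rs" "length rs = length n"
    and rs: "\<And>i. i < length n \<Longrightarrow> rs ! i \<in> row_factorizations n f i" by blast
  have "A $$ (i, j) = rs ! i ! j" if "i < length n" "j < length n" for i j
    unfolding A(1) mat_of_rows_list_def using that A(2) by simp
  moreover have "A \<in> carrier_mat (length n) (length n)"
    unfolding A(1) mat_of_rows_list_def A(2) by (rule mat_carrier)
  ultimately show "A \<in> ?L"
    using rs unfolding row_factorization_matrices_def Let_def n_def[symmetric] row_factorizations_def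
    by force
qed

lemma row_factorization_matrices_4:
  assumes "sorted_list_of_set (minimal_generators S) = [n0, n1, n2, n3]" (is "_ = ?n")
  shows "row_factorization_matrices S f =
    {mat_of_rows_list 4 [r0, r1, r2, r3] | r0 r1 r2 r3.
      r0 \<in> row_factorizations ?n f 0 \<and> r1 \<in> row_factorizations ?n f 1 \<and>
      r2 \<in> row_factorizations ?n f 2 \<and> r3 \<in> row_factorizations ?n f 3}"
proof -
  have len: "length rs = 4 \<longleftrightarrow> (\<exists>r0 r1 r2 r3. rs = [r0, r1, r2, r3])" for rs :: "int list list"
    by (auto simp: eval_nat_numeral length_Suc_conv)
  have all: "(\<forall>i<4. P i) \<longleftrightarrow> P 0 \<and> P 1 \<and> P 2 \<and> P (3::nat)" for P
    by (auto simp: eval_nat_numeral less_Suc_eq)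
  have n4: "length ?n = 4" by simp
  show ?thesis
    unfolding row_factorization_matrices_eq_rows assms n4 len all by (rule Collect_cong) fastforce
qed

lemma row_factorizations_4:
  "row_factorizations [n0, n1, n2, n3] f 0 = {[-1, b, c, d] | b c d.
     0 \<le> b \<and> 0 \<le> c \<and> 0 \<le> d \<and> f + int n0 = b * int n1 + c * int n2 + d * int n3}"
  "row_factorizations [n0, n1, n2, n3] f 1 = {[a, -1, c, d] | a c d.
     0 \<le> a \<and> 0 \<le> c \<and> 0 \<le> d \<and> f + int n1 = a * int n0 + c * int n2 + d * int n3}"
  "row_factorizations [n0, n1, n2, n3] f 2 = {[a, b, -1, d] | a b d.
     0 \<le> a \<and> 0 \<le> b \<and> 0 \<le> d \<and> f + int n2 = a * int n0 + b * int n1 + d * int n3}"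
  "row_factorizations [n0, n1, n2, n3] f 3 = {[a, b, c, -1] | a b c.
     0 \<le> a \<and> 0 \<le> b \<and> 0 \<le> c \<and> f + int n3 = a * int n0 + b * int n1 + c * int n2}"
proof -
  have sum: "(\<Sum>j<4. g j) = g 0 + g 1 + g 2 + g (3::nat)" for g :: "nat \<Rightarrow> int"
    by (simp add: eval_nat_numeral)
  have len: "length r = 4 \<longleftrightarrow> (\<exists>a b c d. r = [a, b, c, d])" for r :: "int list"
    by (auto simp: eval_nat_numeral length_Suc_conv)
  have all: "(\<forall>j<4. P j) \<longleftrightarrow> P 0 \<and> P 1 \<and> P 2 \<and> P (3::nat)" for P
    by (auto simp: eval_nat_numeral less_Suc_eq)
  have n4: "length [n0, n1, n2, n3] = 4" by simp
  note simps = row_factorizations_def n4 sum len all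
  show "row_factorizations [n0, n1, n2, n3] f 0 = {[-1, b, c, d] | b c d.
     0 \<le> b \<and> 0 \<le> c \<and> 0 \<le> d \<and> f + int n0 = b * int n1 + c * int n2 + d * int n3}"
    unfolding simps by auto
  show "row_factorizations [n0, n1, n2, n3] f 1 = {[a, -1, c, d] | a c d.
     0 \<le> a \<and> 0 \<le> c \<and> 0 \<le> d \<and> f + int n1 = a * int n0 + c * int n2 + d * int n3}"
    unfolding simps by auto
  show "row_factorizations [n0, n1, n2, n3] f 2 = {[a, b, -1, d] | a b d.
     0 \<le> a \<and> 0 \<le> b \<and> 0 \<le> d \<and> f + int n2 = a * int n0 + b * int n1 + d * int n3}"
    unfolding simps by auto
  show "row_factorizations [n0, n1, n2, n3] f 3 = {[a, b, c, -1] | a b c.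
     0 \<le> a \<and> 0 \<le> b \<and> 0 \<le> c \<and> f + int n3 = a * int n0 + b * int n1 + c * int n2}"
    unfolding simps by auto
qed

section \<open>Factorizations of small integers\<close>

text \<open>The coefficients belong to \<open>4\<close>, \<open>4 * k + 2\<close>, \<open>4 * q + 1\<close>, \<open>4 * q + 3\<close> in this order for every \<open>k\<close>,
  even for \<open>k = q\<close>, where the generators are not increasing in this order; the permutation is
  accounted for when rows are read off. A row that avoids a generator sets its coefficient
  to \<open>0\<close>.\<close>
definition factorization :: "nat \<Rightarrow> nat \<Rightarrow> int \<Rightarrow> int \<Rightarrow> int \<Rightarrow> int \<Rightarrow> int \<Rightarrow> bool" where
  "factorization k q v x y z w \<longleftrightarrow> 0 \<le> x \<and> 0 \<le> y \<and> 0 \<le> z \<and> 0 \<le> w \<and>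
     v = x * 4 + y * (4 * int k + 2) + z * (4 * int q + 1) + w * (4 * int q + 3)"

text \<open>The two odd generators determine the parity of the sum, and each of them contributes at least
  \<open>4 * q + 1\<close>.\<close>
lemma factorization_odd_generators:
  assumes "factorization k q v x y z w"
  shows "even v \<longleftrightarrow> even (z + w)" and "n \<le> z + w \<Longrightarrow> n * (4 * int q + 1) + 2 * w \<le> v"
proof -
  have v: "v = x * 4 + y * (4 * int k + 2) + ((z + w) * (4 * int q + 1) + 2 * w)"
    using assms unfolding factorization_def by (simp add: algebra_simps)
  show "even v \<longleftrightarrow> even (z + w)" unfolding v by simp
  have "0 \<le> x" "0 \<le> y * (4 * int k + 2)" using assms unfolding factorization_def by auto
  then have le_v: "(z + w) * (4 * int q + 1) + 2 * w \<le> v" using v by linarith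
  show "n * (4 * int q + 1) + 2 * w \<le> v" if "n \<le> z + w"
    by (rule order_trans[OF add_right_mono[OF mult_right_mono[OF that]] le_v]) simp
qed

text \<open>An odd sum uses an odd number of odd generators, and three of them are too many. After
  removing the single odd generator at most \<open>4 * k\<close> remains, which excludes \<open>4 * k + 2\<close>.\<close>
lemma factorization_odd_iff:
  assumes "odd v" "v \<le> 4 * int q + 4 * int k + 1" "k \<le> q"
  shows "factorization k q v x y z w \<longleftrightarrow> 0 \<le> x \<and> y = 0 \<and>
    (z = 1 \<and> w = 0 \<and> 4 * x = v - 4 * int q - 1 \<or> z = 0 \<and> w = 1 \<and> 4 * x = v - 4 * int q - 3)"
proof
  assume F: "factorization k q v x y z w"
  then have nonneg: "0 \<le> x" "0 \<le> y" "0 \<le> z" "0 \<le> w"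
    and v: "v = x * 4 + y * (4 * int k + 2) + z * (4 * int q + 1) + w * (4 * int q + 3)"
    unfolding factorization_def by auto
  have "odd (z + w)" using factorization_odd_generators(1)[OF F] assms(1) by blast
  moreover have "z + w < 2"
  proof (rule ccontr)
    assume "\<not> z + w < 2"
    then have "2 * (4 * int q + 1) + 2 * w \<le> v"
      by (intro factorization_odd_generators(2)[OF F]) simp
    moreover have "int k \<le> int q" using assms(3) by simp
    ultimately show False using nonneg assms(2) by simp
  qed
  ultimately have "z + w = 1" using nonneg by presburger
  then have zw: "z = 1 \<and> w = 0 \<or> z = 0 \<and> w = 1" using nonneg by linarith
  then have "y * (4 * int k + 2) \<le> 4 * int k" using v nonneg assms(2) by auto
  then have "y * (4 * int k + 2) < 1 * (4 * int k + 2)" by (rule le_less_trans) simp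
  then have "y < 1" by (rule mult_right_less_imp_less) simp
  then show "0 \<le> x \<and> y = 0 \<and>
      (z = 1 \<and> w = 0 \<and> 4 * x = v - 4 * int q - 1 \<or> z = 0 \<and> w = 1 \<and> 4 * x = v - 4 * int q - 3)"
    using zw v nonneg by auto
qed (auto simp: factorization_def)

text \<open>An even sum uses no odd generator or at least two, and two of them reach the bound only as
  \<open>(4 * q + 1) + (4 * q + 1)\<close>.\<close>
lemma factorization_even_generators:
  assumes "factorization k q v x y z w" "even v" "v \<le> 8 * int q + 2"
  shows "z = 0 \<and> w = 0 \<or> z = 2 \<and> w = 0 \<and> v = 8 * int q + 2"
proof -
  have nonneg: "0 \<le> z" "0 \<le> w" using assms(1) unfolding factorization_def by auto
  note odd = factorization_odd_generators[OF assms(1)]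
  have "z + w < 3"
  proof (rule ccontr)
    assume "\<not> z + w < 3"
    then have "3 * (4 * int q + 1) + 2 * w \<le> v" by (intro odd(2)) simp
    moreover have "0 \<le> int q" by simp
    ultimately show False using nonneg assms(3) by simp
  qed
  then have "z + w = 0 \<or> z + w = 2" using odd(1) nonneg assms(2) by presburger
  then show ?thesis
  proof
    assume "z + w = 2"
    then have "2 * (4 * int q + 1) + 2 * w \<le> v" by (intro odd(2)) simp
    then show ?thesis using \<open>z + w = 2\<close> nonneg assms(3) by auto
  qed (use nonneg in auto)
qed

text \<open>The coefficient of \<open>4 * k + 2\<close> is even for a multiple of \<open>4\<close>, and half of it is a free parameter.
  The same holds below with an odd coefficient for the residue \<open>2\<close>.\<close>
lemma factorization_0_mod_4_iff:
  assumes "m \<le> 2 * int q"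
  shows "factorization k q (4 * m) x y z w \<longleftrightarrow> z = 0 \<and> w = 0 \<and>
    (\<exists>b::nat. y = 2 * int b \<and> x = m - int b - 2 * int b * int k \<and> 0 \<le> x)"
proof
  assume F: "factorization k q (4 * m) x y z w"
  have "4 * m \<noteq> 8 * int q + 2" by presburger
  then have zw: "z = 0" "w = 0" using factorization_even_generators[OF F] assms by auto
  then have eq: "4 * m = x * 4 + y * (4 * int k + 2)" and nonneg: "0 \<le> x" "0 \<le> y"
    using F unfolding factorization_def by auto
  have half: "2 * m = 2 * x + 2 * (y * int k) + y" using eq by (simp add: algebra_simps)
  then have "even y" by presburger
  then obtain c where c: "y = 2 * c" by (elim dvdE)
  then obtain b where b: "c = int b" using nonneg nonneg_int_cases[of c] by auto
  have "x = m - int b - 2 * int b * int k" using half unfolding c b by (simp add: algebra_simps)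
  then show "z = 0 \<and> w = 0 \<and> (\<exists>b::nat. y = 2 * int b \<and> x = m - int b - 2 * int b * int k \<and> 0 \<le> x)"
    using zw b c nonneg by blast
qed (auto simp: factorization_def algebra_simps)

lemma factorization_2_mod_4_iff:
  assumes "m \<le> 2 * int q"
  shows "factorization k q (4 * m + 2) x y z w \<longleftrightarrow> z = 0 \<and> w = 0 \<and>
      (\<exists>a::nat. 1 \<le> a \<and> y = 2 * int a - 1 \<and> x = m - int a + 1 - (2 * int a - 1) * int k \<and> 0 \<le> x) \<or>
    m = 2 * int q \<and> x = 0 \<and> y = 0 \<and> z = 2 \<and> w = 0"
    (is "_ \<longleftrightarrow> ?R")
proof
  assume F: "factorization k q (4 * m + 2) x y z w"
  then have nonneg: "0 \<le> x" "0 \<le> y"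
    and eq: "4 * m + 2 = x * 4 + y * (4 * int k + 2) + z * (4 * int q + 1) + w * (4 * int q + 3)"
    unfolding factorization_def by auto
  consider "z = 0" "w = 0" | "z = 2" "w = 0" "m = 2 * int q"
    using factorization_even_generators[OF F] assms by auto
  then show ?R
  proof cases
    case 1
    have half: "2 * m + 1 = 2 * x + 2 * (y * int k) + y" using eq 1 by (simp add: algebra_simps)
    then have "odd y" by presburger
    then have "even (y + 1)" by simp
    then obtain c where "y + 1 = 2 * c" by (elim dvdE)
    then have c: "y = 2 * c - 1" by simp
    then have "1 \<le> c" using nonneg by linarith
    then obtain a where a: "c = int a" "1 \<le> a" using nonneg_int_cases[of c] by auto
    have "x = m - int a + 1 - (2 * int a - 1) * int k"
      using half unfolding c a(1) by (simp add: algebra_simps)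
    then show ?thesis using 1 a c nonneg by blast
  next
    case 2
    then have "x * 4 + y * 2 + y * (4 * int k) = 0" using eq by (simp add: distrib_left)
    moreover have "0 \<le> y * (4 * int k)" using nonneg by simp
    ultimately have "x = 0" "y = 0" using nonneg by linarith+
    then show ?thesis using 2 by blast
  qed
next
  assume ?R
  then consider a :: nat where "1 \<le> a" "z = 0" "w = 0" "y = 2 * int a - 1"
      "x = m - int a + 1 - (2 * int a - 1) * int k" "0 \<le> x"
    | "m = 2 * int q" "x = 0" "y = 0" "z = 2" "w = 0"
    by blast
  then show "factorization k q (4 * m + 2) x y z w"
  proof cases
    case 1
    have "4 * m + 2 = (m - int a + 1 - (2 * int a - 1) * int k) * 4 + (2 * int a - 1) * (4 * int k + 2)"
      by (simp add: algebra_simps)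
    then show ?thesis using 1 unfolding factorization_def by simp
  qed (simp add: factorization_def)
qed

section \<open>The row-factorization matrices\<close>

lemma row_factorizations_increasing_generators:
  fixes k q :: nat
  defines "n \<equiv> [4, 4 * k + 2, 4 * q + 1, 4 * q + 3]"
  shows "row_factorizations n f 0 = {[-1, y, z, w] | y z w. factorization k q (f + 4) 0 y z w}"
    and "row_factorizations n f 1 = {[x, -1, z, w] | x z w. factorization k q (f + (4 * int k + 2)) x 0 z w}"
    and "row_factorizations n f 2 = {[x, y, -1, w] | x y w. factorization k q (f + (4 * int q + 1)) x y 0 w}"
    and "row_factorizations n f 3 = {[x, y, z, -1] | x y z. factorization k q (f + (4 * int q + 3)) x y z 0}"
  unfolding n_def row_factorizations_4 factorization_def by (simp_all add: algebra_simps)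

text \<open>For \<open>k = q\<close> the even generator \<open>4 * q + 2\<close> is the third smallest, so the second and third columns
  change places.\<close>
lemma row_factorizations_maximal_embedding_generators:
  fixes q :: nat
  defines "n \<equiv> [4, 4 * q + 1, 4 * q + 2, 4 * q + 3]"
  shows "row_factorizations n f 0 = {[-1, z, y, w] | y z w. factorization q q (f + 4) 0 y z w}"
    and "row_factorizations n f 1 = {[x, -1, y, w] | x y w. factorization q q (f + (4 * int q + 1)) x y 0 w}"
    and "row_factorizations n f 2 = {[x, z, -1, w] | x z w. factorization q q (f + (4 * int q + 2)) x 0 z w}"
    and "row_factorizations n f 3 = {[x, z, y, -1] | x y z. factorization q q (f + (4 * int q + 3)) x y z 0}"
proof -
  have *: "0 \<le> z \<and> 0 \<le> y \<and> 0 \<le> w \<and> f + int 4 = z * int (4 * q + 1) + y * int (4 * q + 2) + w * int (4 * q + 3)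
      \<longleftrightarrow> factorization q q (f + 4) 0 y z w" for y z w
    by (auto simp: factorization_def algebra_simps)
  show "row_factorizations n f 0 = {[-1, z, y, w] | y z w. factorization q q (f + 4) 0 y z w}"
    unfolding n_def row_factorizations_4 * by blast
  have *: "0 \<le> x \<and> 0 \<le> y \<and> 0 \<le> w \<and> f + int (4 * q + 1) = x * int 4 + y * int (4 * q + 2) + w * int (4 * q + 3)
      \<longleftrightarrow> factorization q q (f + (4 * int q + 1)) x y 0 w" for x y w
    by (auto simp: factorization_def algebra_simps)
  show "row_factorizations n f 1 = {[x, -1, y, w] | x y w. factorization q q (f + (4 * int q + 1)) x y 0 w}"
    unfolding n_def row_factorizations_4 * by blast
  have *: "0 \<le> x \<and> 0 \<le> z \<and> 0 \<le> w \<and> f + int (4 * q + 2) = x * int 4 + z * int (4 * q + 1) + w * int (4 * q + 3)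
      \<longleftrightarrow> factorization q q (f + (4 * int q + 2)) x 0 z w" for x z w
    by (auto simp: factorization_def algebra_simps)
  show "row_factorizations n f 2 = {[x, z, -1, w] | x z w. factorization q q (f + (4 * int q + 2)) x 0 z w}"
    unfolding n_def row_factorizations_4 * by blast
  have *: "0 \<le> x \<and> 0 \<le> z \<and> 0 \<le> y \<and> f + int (4 * q + 3) = x * int 4 + z * int (4 * q + 1) + y * int (4 * q + 2)
      \<longleftrightarrow> factorization q q (f + (4 * int q + 3)) x y z 0" for x y z
    by (auto simp: factorization_def algebra_simps)
  show "row_factorizations n f 3 = {[x, z, y, -1] | x y z. factorization q q (f + (4 * int q + 3)) x y z 0}"
    unfolding n_def row_factorizations_4 * by blast
qed

text \<open>This lemma and the next two evaluate, for each pseudo-Frobenius number \<open>f\<close>, the factorizations of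
  \<open>f\<close> plus a generator that avoid this generator. They allow \<open>k = q\<close>, so that both alternatives of
  the classification use them.\<close>
lemma factorization_rows_4k_minus_2:
  assumes "1 \<le> k" "k \<le> q"
  shows "factorization k q (4 * int k - 2 + 4) 0 y z w \<longleftrightarrow> y = 1 \<and> z = 0 \<and> w = 0"
    and "factorization k q (4 * int k - 2 + (4 * int k + 2)) x 0 z w \<longleftrightarrow> x = 2 * int k \<and> z = 0 \<and> w = 0"
    and "factorization k q (4 * int k - 2 + (4 * int q + 1)) x y 0 w \<longleftrightarrow> x = int k - 1 \<and> y = 0 \<and> w = 1"
    and "factorization k q (4 * int k - 2 + (4 * int q + 3)) x y z 0 \<longleftrightarrow> x = int k \<and> y = 0 \<and> z = 1"
proof -
  have kq: "int k \<le> int q" "1 \<le> int k" using assms by simp_all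
  have "factorization k q (4 * int k - 2 + 4) 0 y z w \<Longrightarrow> y = 1 \<and> z = 0 \<and> w = 0"
  proof -
    assume F: "factorization k q (4 * int k - 2 + 4) 0 y z w"
    have "z = 0 \<and> w = 0" using factorization_even_generators[OF F] kq by simp
    then have "2 + 4 * int k = y * (4 * int k + 2)" using F unfolding factorization_def by simp
    then have "4 * int k + 2 = y * (4 * int k + 2)" by (simp only: add.commute)
    then have "4 * int k + 2 = 0 \<or> y = 1" by (simp only: mult_cancel_right1)
    then have "y = 1" by presburger
    then show ?thesis using \<open>z = 0 \<and> w = 0\<close> by simp
  qed
  then show "factorization k q (4 * int k - 2 + 4) 0 y z w \<longleftrightarrow> y = 1 \<and> z = 0 \<and> w = 0"
    by (auto simp: factorization_def)
  have eq: "4 * int k - 2 + (4 * int k + 2) = 4 * (2 * int k)" by simp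
  show "factorization k q (4 * int k - 2 + (4 * int k + 2)) x 0 z w \<longleftrightarrow> x = 2 * int k \<and> z = 0 \<and> w = 0"
    unfolding eq using kq by (subst factorization_0_mod_4_iff) auto
  show "factorization k q (4 * int k - 2 + (4 * int q + 1)) x y 0 w \<longleftrightarrow> x = int k - 1 \<and> y = 0 \<and> w = 1"
    using kq assms by (subst factorization_odd_iff) auto
  show "factorization k q (4 * int k - 2 + (4 * int q + 3)) x y z 0 \<longleftrightarrow> x = int k \<and> y = 0 \<and> z = 1"
    using kq assms by (subst factorization_odd_iff) auto
qed

lemma factorization_rows_4q_minus_3:
  assumes "1 \<le> k" "k \<le> q"
  shows "factorization k q (4 * int q - 3 + 4) 0 y z w \<longleftrightarrow> y = 0 \<and> z = 1 \<and> w = 0"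
    and "factorization k q (4 * int q - 3 + (4 * int k + 2)) x 0 z w \<longleftrightarrow> x = int k - 1 \<and> z = 0 \<and> w = 1"
    and "factorization k q (4 * int q - 3 + (4 * int q + 1)) x y 0 w \<longleftrightarrow> w = 0 \<and>
      (\<exists>a::nat. 1 \<le> a \<and> y = 2 * int a - 1 \<and> x = 2 * int q - int a - (2 * int a - 1) * int k \<and> 0 \<le> x)"
    and "factorization k q (4 * int q - 3 + (4 * int q + 3)) x y z 0 \<longleftrightarrow> z = 0 \<and>
      (\<exists>b::nat. y = 2 * int b \<and> x = 2 * int q - int b - 2 * int b * int k \<and> 0 \<le> x)"
proof -
  have kq: "int k \<le> int q" "1 \<le> int k" using assms by simp_all
  show "factorization k q (4 * int q - 3 + 4) 0 y z w \<longleftrightarrow> y = 0 \<and> z = 1 \<and> w = 0"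
    using kq assms by (subst factorization_odd_iff) auto
  show "factorization k q (4 * int q - 3 + (4 * int k + 2)) x 0 z w \<longleftrightarrow> x = int k - 1 \<and> z = 0 \<and> w = 1"
    using kq assms by (subst factorization_odd_iff) (auto, presburger+)
  have eq: "4 * int q - 3 + (4 * int q + 1) = 4 * (2 * int q - 1) + 2"
    "4 * int q - 3 + (4 * int q + 3) = 4 * (2 * int q)" by simp_all
  show "factorization k q (4 * int q - 3 + (4 * int q + 1)) x y 0 w \<longleftrightarrow> w = 0 \<and>
      (\<exists>a::nat. 1 \<le> a \<and> y = 2 * int a - 1 \<and> x = 2 * int q - int a - (2 * int a - 1) * int k \<and> 0 \<le> x)"
    unfolding eq by (subst factorization_2_mod_4_iff) auto
  show "factorization k q (4 * int q - 3 + (4 * int q + 3)) x y z 0 \<longleftrightarrow> z = 0 \<and>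
      (\<exists>b::nat. y = 2 * int b \<and> x = 2 * int q - int b - 2 * int b * int k \<and> 0 \<le> x)"
    unfolding eq by (subst factorization_0_mod_4_iff) auto
qed

lemma factorization_rows_4q_minus_1:
  assumes "1 \<le> k" "k \<le> q"
  shows "factorization k q (4 * int q - 1 + 4) 0 y z w \<longleftrightarrow> y = 0 \<and> z = 0 \<and> w = 1"
    and "factorization k q (4 * int q - 1 + (4 * int k + 2)) x 0 z w \<longleftrightarrow> x = int k \<and> z = 1 \<and> w = 0"
    and "factorization k q (4 * int q - 1 + (4 * int q + 1)) x y 0 w \<longleftrightarrow> w = 0 \<and>
      (\<exists>b::nat. y = 2 * int b \<and> x = 2 * int q - int b - 2 * int b * int k \<and> 0 \<le> x)"
    and "factorization k q (4 * int q - 1 + (4 * int q + 3)) x y z 0 \<longleftrightarrow> z = 0 \<and>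
      (\<exists>a::nat. 1 \<le> a \<and> y = 2 * int a - 1 \<and> x = 2 * int q - int a + 1 - (2 * int a - 1) * int k \<and> 0 \<le> x)
      \<or> x = 0 \<and> y = 0 \<and> z = 2"
proof -
  have kq: "int k \<le> int q" "1 \<le> int k" using assms by simp_all
  show "factorization k q (4 * int q - 1 + 4) 0 y z w \<longleftrightarrow> y = 0 \<and> z = 0 \<and> w = 1"
    using kq assms by (subst factorization_odd_iff) auto
  show "factorization k q (4 * int q - 1 + (4 * int k + 2)) x 0 z w \<longleftrightarrow> x = int k \<and> z = 1 \<and> w = 0"
    using kq assms by (subst factorization_odd_iff) (auto, presburger+)
  have eq: "4 * int q - 1 + (4 * int q + 1) = 4 * (2 * int q)"
    "4 * int q - 1 + (4 * int q + 3) = 4 * (2 * int q) + 2" by simp_all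
  show "factorization k q (4 * int q - 1 + (4 * int q + 1)) x y 0 w \<longleftrightarrow> w = 0 \<and>
      (\<exists>b::nat. y = 2 * int b \<and> x = 2 * int q - int b - 2 * int b * int k \<and> 0 \<le> x)"
    unfolding eq by (subst factorization_0_mod_4_iff) auto
  show "factorization k q (4 * int q - 1 + (4 * int q + 3)) x y z 0 \<longleftrightarrow> z = 0 \<and>
      (\<exists>a::nat. 1 \<le> a \<and> y = 2 * int a - 1 \<and> x = 2 * int q - int a + 1 - (2 * int a - 1) * int k \<and> 0 \<le> x)
      \<or> x = 0 \<and> y = 0 \<and> z = 2"
    unfolding eq by (subst factorization_2_mod_4_iff) auto
qed

text \<open>The real bounds on the parameters are exactly the non-negativity of the coefficient of \<open>4\<close>.\<close>
lemma le_divide_iff_nonneg: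
  fixes k q s a :: nat
  assumes "s = 4 * q"
  shows "real a \<le> (real s + 2 * real k) / (2 * (2 * real k + 1)) \<longleftrightarrow>
      0 \<le> 2 * int q - int a - (2 * int a - 1) * int k"
    and "real a \<le> (real s + 2 * real k + 2) / (2 * (2 * real k + 1)) \<longleftrightarrow>
      0 \<le> 2 * int q - int a + 1 - (2 * int a - 1) * int k"
    and "real a \<le> real s / (2 * (2 * real k + 1)) \<longleftrightarrow>
      0 \<le> 2 * int q - int a - 2 * int a * int k"
proof -
  have pos: "0 < 2 * (2 * real k + 1)" by simp
  show "real a \<le> (real s + 2 * real k) / (2 * (2 * real k + 1)) \<longleftrightarrow>
      0 \<le> 2 * int q - int a - (2 * int a - 1) * int k"
    unfolding assms pos_le_divide_eq[OF pos] of_int_0_le_iff[where ?'a = real, symmetric]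
    by (auto simp: algebra_simps)
  show "real a \<le> (real s + 2 * real k + 2) / (2 * (2 * real k + 1)) \<longleftrightarrow>
      0 \<le> 2 * int q - int a + 1 - (2 * int a - 1) * int k"
    unfolding assms pos_le_divide_eq[OF pos] of_int_0_le_iff[where ?'a = real, symmetric]
    by (auto simp: algebra_simps)
  show "real a \<le> real s / (2 * (2 * real k + 1)) \<longleftrightarrow>
      0 \<le> 2 * int q - int a - 2 * int a * int k"
    unfolding assms pos_le_divide_eq[OF pos] of_int_0_le_iff[where ?'a = real, symmetric]
    by (auto simp: algebra_simps)
qed

lemma row_factorization_matrices_two_mod_4_generator:
  assumes "minimal_generators S = {4, 4 * k + 2, 4 * q + 1, 4 * q + 3}" "1 \<le> k" "k < q"
  shows "row_factorization_matrices S (4 * int k - 2) =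
      {mat_of_rows_list 4
        [[-1, 1, 0, 0],
         [2 * int k, -1, 0, 0],
         [int k - 1, 0, -1, 1],
         [int k, 0, 1, -1]]}" (is ?A)
    and "row_factorization_matrices S (4 * int q - 3) =
      {mat_of_rows_list 4
        [[-1, 0, 1, 0],
         [int k - 1, -1, 0, 1],
         [2 * int q - int a - (2 * int a - 1) * int k, 2 * int a - 1, -1, 0],
         [2 * int q - int b - 2 * int b * int k, 2 * int b, 0, -1]] | a b :: nat.
        1 \<le> a \<and> 0 \<le> 2 * int q - int a - (2 * int a - 1) * int k \<and>
        0 \<le> 2 * int q - int b - 2 * int b * int k}" (is ?B)
    and "row_factorization_matrices S (4 * int q - 1) =
      {mat_of_rows_list 4
        [[-1, 0, 0, 1],
         [int k, -1, 1, 0],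
         [2 * int q - int b - 2 * int b * int k, 2 * int b, -1, 0],
         [2 * int q - int a + 1 - (2 * int a - 1) * int k, 2 * int a - 1, 0, -1]] | a b :: nat.
        1 \<le> a \<and> 0 \<le> 2 * int q - int a + 1 - (2 * int a - 1) * int k \<and>
        0 \<le> 2 * int q - int b - 2 * int b * int k} \<union>
      {mat_of_rows_list 4
        [[-1, 0, 0, 1],
         [int k, -1, 1, 0],
         [2 * int q - int b - 2 * int b * int k, 2 * int b, -1, 0],
         [0, 0, 2, -1]] | b :: nat.
        0 \<le> 2 * int q - int b - 2 * int b * int k}" (is ?C)
proof -
  have le: "k \<le> q" using assms(3) by simp
  have "sorted_list_of_set (minimal_generators S) = [4, 4 * k + 2, 4 * q + 1, 4 * q + 3]" (is "_ = ?n")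
    unfolding assms(1) using assms(2,3) by (intro sorted_list_of_set_unique[THEN iffD1]) auto
  note mats = row_factorization_matrices_4[OF this]
  note rows = row_factorizations_increasing_generators
  have "row_factorizations ?n (4 * int k - 2) 0 = {[-1, 1, 0, 0]}"
    "row_factorizations ?n (4 * int k - 2) 1 = {[2 * int k, -1, 0, 0]}"
    "row_factorizations ?n (4 * int k - 2) 2 = {[int k - 1, 0, -1, 1]}"
    "row_factorizations ?n (4 * int k - 2) 3 = {[int k, 0, 1, -1]}"
    unfolding rows factorization_rows_4k_minus_2[OF assms(2) le] by blast+
  then show ?A unfolding mats by simp
  have "row_factorizations ?n (4 * int q - 3) 0 = {[-1, 0, 1, 0]}"
    "row_factorizations ?n (4 * int q - 3) 1 = {[int k - 1, -1, 0, 1]}"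
    "row_factorizations ?n (4 * int q - 3) 2 =
      {[2 * int q - int a - (2 * int a - 1) * int k, 2 * int a - 1, -1, 0] | a :: nat.
        1 \<le> a \<and> 0 \<le> 2 * int q - int a - (2 * int a - 1) * int k}"
    "row_factorizations ?n (4 * int q - 3) 3 =
      {[2 * int q - int b - 2 * int b * int k, 2 * int b, 0, -1] | b :: nat.
        0 \<le> 2 * int q - int b - 2 * int b * int k}"
    unfolding rows factorization_rows_4q_minus_3[OF assms(2) le] by blast+
  then show ?B by (simp only: mats) blast
  have "row_factorizations ?n (4 * int q - 1) 0 = {[-1, 0, 0, 1]}"
    "row_factorizations ?n (4 * int q - 1) 1 = {[int k, -1, 1, 0]}"
    "row_factorizations ?n (4 * int q - 1) 2 =
      {[2 * int q - int b - 2 * int b * int k, 2 * int b, -1, 0] | b :: nat.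
        0 \<le> 2 * int q - int b - 2 * int b * int k}"
    "row_factorizations ?n (4 * int q - 1) 3 =
      {[2 * int q - int a + 1 - (2 * int a - 1) * int k, 2 * int a - 1, 0, -1] | a :: nat.
        1 \<le> a \<and> 0 \<le> 2 * int q - int a + 1 - (2 * int a - 1) * int k} \<union> {[0, 0, 2, -1]}"
    unfolding rows factorization_rows_4q_minus_1[OF assms(2) le] by blast+
  then show ?C by (simp only: mats) blast
qed

text \<open>For \<open>k = q\<close> two copies of \<open>4 * q + 2\<close> exceed \<open>8 * q + 2\<close>, so the parameters take only the values
  \<open>a = 1\<close> and \<open>b = 0\<close> and every family collapses to one row.\<close>
lemma row_factorization_matrices_maximal_embedding:
  assumes "minimal_generators S = {4, 4 * q + 1, 4 * q + 2, 4 * q + 3}" "1 \<le> q"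
  shows "row_factorization_matrices S (4 * int q - 3) =
      {mat_of_rows_list 4
        [[-1, 1, 0, 0],
         [int q - 1, -1, 1, 0],
         [int q - 1, 0, -1, 1],
         [2 * int q, 0, 0, -1]]}" (is ?A)
    and "row_factorization_matrices S (4 * int q - 2) =
      {mat_of_rows_list 4
        [[-1, 0, 1, 0],
         [int q - 1, -1, 0, 1],
         [2 * int q, 0, -1, 0],
         [int q, 1, 0, -1]]}" (is ?B)
    and "row_factorization_matrices S (4 * int q - 1) =
      {mat_of_rows_list 4
        [[-1, 0, 0, 1],
         [2 * int q, -1, 0, 0],
         [int q, 1, -1, 0],
         [int q, 0, 1, -1]],
       mat_of_rows_list 4
        [[-1, 0, 0, 1],
         [2 * int q, -1, 0, 0],
         [int q, 1, -1, 0],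
         [0, 2, 0, -1]]}" (is ?C)
proof -
  have "sorted_list_of_set (minimal_generators S) = [4, 4 * q + 1, 4 * q + 2, 4 * q + 3]" (is "_ = ?n")
    unfolding assms(1) using assms(2) by (intro sorted_list_of_set_unique[THEN iffD1]) auto
  note mats = row_factorization_matrices_4[OF this]
  note rows = row_factorizations_maximal_embedding_generators
  \<comment> \<open>The weaker of the two bounds on \<open>a\<close>, so that it serves both \<open>odd1\<close> and \<open>odd2\<close>.\<close>
  have small: "a = 1" if "1 \<le> a" "0 \<le> 2 * int q - int a + 1 - (2 * int a - 1) * int q" for a :: nat
  proof (rule ccontr)
    assume "a \<noteq> 1"
    then have "3 * int q \<le> (2 * int a - 1) * int q" using that(1) by (intro mult_right_mono) auto
    then have "2 * int q - int a + 1 - (2 * int a - 1) * int q \<le> 2 * int q - int a + 1 - 3 * int q"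
      by (rule diff_left_mono)
    then have "0 \<le> 2 * int q - int a + 1 - 3 * int q" by (rule order_trans[OF that(2)])
    then show False using that(1) assms(2) by simp
  qed
  have odd1: "(\<exists>a::nat. 1 \<le> a \<and> y = 2 * int a - 1 \<and>
      x = 2 * int q - int a - (2 * int a - 1) * int q \<and> 0 \<le> x) \<longleftrightarrow> y = 1 \<and> x = int q - 1" for x y
  proof
    assume "\<exists>a::nat. 1 \<le> a \<and> y = 2 * int a - 1 \<and>
      x = 2 * int q - int a - (2 * int a - 1) * int q \<and> 0 \<le> x"
    then obtain a :: nat where a: "1 \<le> a" "y = 2 * int a - 1"
      "x = 2 * int q - int a - (2 * int a - 1) * int q" "0 \<le> x" by blast
    then have "a = 1" by (intro small) auto
    then show "y = 1 \<and> x = int q - 1" using a by simp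
  qed (use assms(2) in \<open>auto intro!: exI[of _ 1]\<close>)
  have odd2: "(\<exists>a::nat. 1 \<le> a \<and> y = 2 * int a - 1 \<and>
      x = 2 * int q - int a + 1 - (2 * int a - 1) * int q \<and> 0 \<le> x) \<longleftrightarrow> y = 1 \<and> x = int q" for x y
  proof
    assume "\<exists>a::nat. 1 \<le> a \<and> y = 2 * int a - 1 \<and>
      x = 2 * int q - int a + 1 - (2 * int a - 1) * int q \<and> 0 \<le> x"
    then obtain a :: nat where a: "1 \<le> a" "y = 2 * int a - 1"
      "x = 2 * int q - int a + 1 - (2 * int a - 1) * int q" "0 \<le> x" by blast
    then have "a = 1" by (intro small) auto
    then show "y = 1 \<and> x = int q" using a by simp
  qed (auto intro!: exI[of _ 1])
  have even: "(\<exists>b::nat. y = 2 * int b \<and> x = 2 * int q - int b - 2 * int b * int q \<and> 0 \<le> x)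
      \<longleftrightarrow> y = 0 \<and> x = 2 * int q" for x y
  proof
    assume "\<exists>b::nat. y = 2 * int b \<and> x = 2 * int q - int b - 2 * int b * int q \<and> 0 \<le> x"
    then obtain b :: nat where b: "y = 2 * int b" "x = 2 * int q - int b - 2 * int b * int q" "0 \<le> x"
      by blast
    have "b = 0"
    proof (rule ccontr)
      assume "b \<noteq> 0"
      then have "2 * int q \<le> 2 * int b * int q" by (intro mult_right_mono) auto
      then have "2 * int q - int b - 2 * int b * int q \<le> 2 * int q - int b - 2 * int q"
        by (rule diff_left_mono)
      then have "0 \<le> 2 * int q - int b - 2 * int q" by (rule order_trans[OF b(3)[unfolded b(2)]])
      then show False using \<open>b \<noteq> 0\<close> by simp
    qed
    then show "y = 0 \<and> x = 2 * int q" using b by simp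
  qed auto
  have "row_factorizations ?n (4 * int q - 3) 0 = {[-1, 1, 0, 0]}"
    "row_factorizations ?n (4 * int q - 3) 1 = {[int q - 1, -1, 1, 0]}"
    "row_factorizations ?n (4 * int q - 3) 2 = {[int q - 1, 0, -1, 1]}"
    "row_factorizations ?n (4 * int q - 3) 3 = {[2 * int q, 0, 0, -1]}"
    unfolding rows factorization_rows_4q_minus_3[OF assms(2) order_refl] odd1 even by blast+
  then show ?A unfolding mats by simp
  have "row_factorizations ?n (4 * int q - 2) 0 = {[-1, 0, 1, 0]}"
    "row_factorizations ?n (4 * int q - 2) 1 = {[int q - 1, -1, 0, 1]}"
    "row_factorizations ?n (4 * int q - 2) 2 = {[2 * int q, 0, -1, 0]}"
    "row_factorizations ?n (4 * int q - 2) 3 = {[int q, 1, 0, -1]}"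
    unfolding rows factorization_rows_4k_minus_2[OF assms(2) order_refl] by blast+
  then show ?B unfolding mats by simp
  have "row_factorizations ?n (4 * int q - 1) 0 = {[-1, 0, 0, 1]}"
    "row_factorizations ?n (4 * int q - 1) 1 = {[2 * int q, -1, 0, 0]}"
    "row_factorizations ?n (4 * int q - 1) 2 = {[int q, 1, -1, 0]}"
    "row_factorizations ?n (4 * int q - 1) 3 = {[int q, 0, 1, -1], [0, 2, 0, -1]}"
    unfolding rows factorization_rows_4q_minus_1[OF assms(2) order_refl] odd2 even by blast+
  then show ?C by (simp only: mats) blast
qed

section \<open>The classification\<close>

theorem proposition3p4:
  fixes S :: "nat set" and s :: nat
  assumes "numerical_semigroup S"
    and "arf S"
    and "semigroup_multiplicity S = 4"
    and "conductor S = int s"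
    and "s \<ge> 4"
    and "s mod 4 = 0"
  shows
   "(\<exists>k::nat. 1 \<le> k \<and> real k < real s / 4 \<and>
       S = nat_span {4, 4 * k + 2, s + 1, s + 3} \<and>
       pseudo_frobenius S = {4 * int k - 2, int s - 3, int s - 1} \<and>
       row_factorization_matrices S (4 * int k - 2) =
         {mat_of_rows_list 4
            [[-1, 1, 0, 0],
             [2 * int k, -1, 0, 0],
             [int k - 1, 0, -1, 1],
             [int k, 0, 1, -1]]} \<and>
       row_factorization_matrices S (int s - 3) =
         {mat_of_rows_list 4
            [[-1, 0, 1, 0],
             [int k - 1, -1, 0, 1],
             [int s div 2 - int a - (2 * int a - 1) * int k, 2 * int a - 1, -1, 0],
             [int s div 2 - int b - 2 * int b * int k, 2 * int b, 0, -1]] | a b :: nat.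
            1 \<le> a \<and> real a \<le> (real s + 2 * real k) / (2 * (2 * real k + 1)) \<and>
            0 \<le> b \<and> real b \<le> real s / (2 * (2 * real k + 1))} \<and>
       row_factorization_matrices S (int s - 1) =
         {mat_of_rows_list 4
            [[-1, 0, 0, 1],
             [int k, -1, 1, 0],
             [int s div 2 - int b - 2 * int b * int k, 2 * int b, -1, 0],
             [int s div 2 - int a + 1 - (2 * int a - 1) * int k, 2 * int a - 1, 0, -1]] | a b :: nat.
            1 \<le> a \<and> real a \<le> (real s + 2 * real k + 2) / (2 * (2 * real k + 1)) \<and>
            0 \<le> b \<and> real b \<le> real s / (2 * (2 * real k + 1))} \<union>
         {mat_of_rows_list 4
            [[-1, 0, 0, 1],
             [int k, -1, 1, 0],
             [int s div 2 - int b - 2 * int b * int k, 2 * int b, -1, 0],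
             [0, 0, 2, -1]] | b :: nat.
            0 \<le> b \<and> real b \<le> real s / (2 * (2 * real k + 1))})
    \<or>
    (S = nat_span {4, s + 1, s + 2, s + 3} \<and>
       pseudo_frobenius S = {int s - 3, int s - 2, int s - 1} \<and>
       row_factorization_matrices S (int s - 3) =
         {mat_of_rows_list 4
            [[-1, 1, 0, 0],
             [(int s - 4) div 4, -1, 1, 0],
             [(int s - 4) div 4, 0, -1, 1],
             [int s div 2, 0, 0, -1]]} \<and>
       row_factorization_matrices S (int s - 2) =
         {mat_of_rows_list 4
            [[-1, 0, 1, 0],
             [(int s - 4) div 4, -1, 0, 1],
             [int s div 2, 0, -1, 0],
             [int s div 4, 1, 0, -1]]} \<and>
       row_factorization_matrices S (int s - 1) =
         {mat_of_rows_list 4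
            [[-1, 0, 0, 1],
             [int s div 2, -1, 0, 0],
             [int s div 4, 1, -1, 0],
             [int s div 4, 0, 1, -1]],
          mat_of_rows_list 4
            [[-1, 0, 0, 1],
             [int s div 2, -1, 0, 0],
             [int s div 4, 1, -1, 0],
             [0, 2, 0, -1]]})"
proof -
  obtain q where s: "s = 4 * q" using assms(6) by auto
  then have "1 \<le> q" using assms(5) by simp
  obtain k where k: "1 \<le> k" "k \<le> q" and S: "S = even_gap_semigroup k q"
    using arf_multiplicity_4_eq_even_gap_semigroup[OF assms(1-3) _ \<open>1 \<le> q\<close>] assms(4) unfolding s by blast
  have span: "S = nat_span {4, 4 * k + 2, s + 1, s + 3}"
    unfolding S s using nat_span_even_gap_semigroup[OF k] by simp
  have gens: "minimal_generators S = {4, 4 * k + 2, 4 * q + 1, 4 * q + 3}"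
    unfolding S by (rule minimal_generators_even_gap_semigroup[OF assms(1)[unfolded S] k])
  have pf: "pseudo_frobenius S = {4 * int k - 2, int s - 3, int s - 1}"
    unfolding S s using pseudo_frobenius_even_gap_semigroup[OF k] by simp
  have int_s: "int s = 4 * int q" "int s div 2 = 2 * int q" "int s div 4 = int q"
      "(int s - 4) div 4 = int q - 1"
    unfolding s by simp_all
  show ?thesis
  proof (cases "k < q")
    case True
    then have "real k < real s / 4" unfolding s by simp
    note bounds = le_divide_iff_nonneg[OF s] le0 simp_thms
    note mats = row_factorization_matrices_two_mod_4_generator[OF gens k(1) True]
    show ?thesis
    proof (intro disjI1 exI[of _ k] conjI)
      show "1 \<le> k" "real k < real s / 4" "S = nat_span {4, 4 * k + 2, s + 1, s + 3}"
        "pseudo_frobenius S = {4 * int k - 2, int s - 3, int s - 1}"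
        by fact+
    qed (simp_all only: int_s(2) bounds, simp_all only: int_s(1) mats)
  next
    case False
    then have "k = q" using k(2) by simp
    then have "minimal_generators S = {4, 4 * q + 1, 4 * q + 2, 4 * q + 3}"
      using gens by (simp add: insert_commute)
    moreover have "S = nat_span {4, s + 1, s + 2, s + 3}"
      using span unfolding \<open>k = q\<close> s by (simp add: insert_commute)
    moreover have "pseudo_frobenius S = {int s - 3, int s - 2, int s - 1}"
      using pf unfolding \<open>k = q\<close> s by (simp add: insert_commute)
    ultimately show ?thesis
      using row_factorization_matrices_maximal_embedding[of S q] \<open>1 \<le> q\<close>
      unfolding int_s(2-4) unfolding int_s(1)
      by (intro disjI2 conjI) simp_all
  qed
qed

end
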